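(* Let $n \geq 1$ and write $n = 2^{j_1} + 2^{j_2} + \cdots + 2^{j_k}$ with $0 \leq j_1 < j_2 < \cdots < j_k$. For $t \in \mathbf{Z}$ let $$\mathcal{K}_n^{(t)}(x) = \sum_{j=0}^{n} (-2)^j \binom{t-j}{n-j}\binom{x}{j} \in \mathbf{Q}[x].$$ Then for every integer $t$ with $n \leq t < n + 2^{j_1}$, the $2$-adic Newton polygon of $\mathcal{K}_n^{(t)}(x)$ is degree-based, i.e. it consists, read from left to right, of segments of horizontal lengths $2^{j_1}, 2^{j_2}, \dots, 2^{j_k}$ with slopes $-2^{-j_1}, -2^{-j_2}, \dots, -2^{-j_k}$, respectively.
   Context: Here $\binom{x}{j} = \frac{x(x-1)\cdots(x-j+1)}{j!}$. For a polynomial $f(x) = \sum_{j=0}^{n} a_j x^j \in \mathbf{Q}[x]$ of degree $n$ and a prime $p$, the $p$-adic Newton polygon $\operatorname{NP}_p(f)$ is the lower convex hull of the points $(n-j, v_p(a_j))$ for those $j$ with $a_j \neq 0$, where $v_p$ is the $p$-adic valuation. (Thus the leftmost point corresponds to the leading coefficient and the rightmost to the constant coefficient.) *)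

theory Defs
  imports "HOL-Analysis.Analysis" "HOL-Computational_Algebra.Computational_Algebra"
begin

text \<open>Meaningful for prime \<open>p\<close> and \<open>q \<noteq> 0\<close>; by the convention for multiplicity the value at \<open>0\<close>
  is \<open>0\<close> rather than infinity.\<close>

definition padic_val :: "nat \<Rightarrow> rat \<Rightarrow> int" where
  "padic_val p q = int (multiplicity (int p) (fst (quotient_of q)))
                 - int (multiplicity (int p) (snd (quotient_of q)))"

definition newton_points :: "nat \<Rightarrow> rat poly \<Rightarrow> (real \<times> real) set" where
  "newton_points p f =
     {(real (degree f - j), real_of_int (padic_val p (coeff f j))) | j. coeff f j \<noteq> 0}"

definition lower_convex_hull :: "(real \<times> real) set \<Rightarrow> (real \<times> real) set" where
  "lower_convex_hull S =
     {(x, y). (x, y) \<in> convex hull S \<and> (\<forall>y'. (x, y') \<in> convex hull S \<longrightarrow> y \<le> y')}"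

definition newton_polygon :: "nat \<Rightarrow> rat poly \<Rightarrow> (real \<times> real) set" where
  "newton_polygon p f = lower_convex_hull (newton_points p f)"

text \<open>\<open>P\<close> is a polygonal line with vertices \<open>V 0, \<dots>, V k\<close> from left to right, whose \<open>i\<close>-th segment
  (\<open>1 \<le> i \<le> k\<close>) has horizontal length \<open>l i\<close> and slope \<open>s i\<close>. Requiring the slopes to increase
  strictly prevents an edge of a convex polygonal line from being subdivided artificially.\<close>

definition consists_of_segments ::
  "(real \<times> real) set \<Rightarrow> nat \<Rightarrow> (nat \<Rightarrow> real) \<Rightarrow> (nat \<Rightarrow> real) \<Rightarrow> bool" where
  "consists_of_segments P k l s \<longleftrightarrow>
     (\<forall>i\<in>{1..k}. l i > 0) \<and> strict_mono_on {1..k} s \<and>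
     (\<exists>V :: nat \<Rightarrow> real \<times> real.
        P = (\<Union>i\<in>{1..k}. closed_segment (V (i - 1)) (V i)) \<and>
        (\<forall>i\<in>{1..k}. fst (V i) - fst (V (i - 1)) = l i \<and>
                     snd (V i) - snd (V (i - 1)) = s i * l i))"

definition binomial_poly :: "nat \<Rightarrow> rat poly" where
  "binomial_poly j = smult (1 / fact j) (\<Prod>i<j. [:- of_nat i, 1:])"

lemma poly_binomial_poly: "poly (binomial_poly j) x = x gchoose j"
  by (simp add: binomial_poly_def gbinomial_prod_rev poly_prod atLeast0LessThan)

definition kraw :: "nat \<Rightarrow> int \<Rightarrow> rat poly" where
  "kraw n t =
     (\<Sum>j=0..n. smult ((- 2) ^ j * (of_int (t - int j) gchoose (n - j))) (binomial_poly j))"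

end

theory Submission
  imports Defs
begin

text \<open>
  By Legendre's formula \<open>2 ^ c / c!\<close> has 2-adic valuation \<open>s c\<close>, the binary digit sum of \<open>c\<close>.
  Hence the coefficient of \<open>x ^ m\<close> is a sum over \<open>m \<le> c \<le> n\<close> of terms of valuation at least \<open>s c\<close>.
  Let \<open>M\<close> be the sum of the powers of two in \<open>n\<close> beyond the \<open>i\<close>-th one. Monotonicity of
  \<open>v\<^sub>2 (q!) = q - s q\<close> yields \<open>s c \<ge> s M + (c - M) / 2 ^ j\<^sub>i\<close> for all \<open>c \<le> n\<close>: the points lie above
  the line of the \<open>i\<close>-th segment. Equality holds at the vertices because there the terms with
  \<open>c > M\<close> have valuation greater than \<open>s M\<close>, whereas the term \<open>c = M\<close> has valuation exactly \<open>s M\<close>: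
  adding \<open>t - n < 2 ^ j\<^sub>1\<close> to \<open>n - M\<close> produces no carry, so the binomial coefficient is odd.
\<close>

section \<open>Lower convex hulls\<close>

text \<open>The line is anchored at the right endpoint, matching the form in which supporting lines
  appear in the hull lemma below.\<close>

lemma closed_segment_graph:
  fixes s :: real and P Q :: "real \<times> real"
  assumes "fst P < fst Q" and "snd Q - snd P = s * (fst Q - fst P)"
  shows "closed_segment P Q = {(x, y). fst P \<le> x \<and> x \<le> fst Q \<and> y = snd Q + s * (x - fst Q)}"
    (is "_ = ?R")
proof (intro equalityI subsetI)
  fix z assume "z \<in> closed_segment P Q"
  then obtain u where u: "0 \<le> u" "u \<le> 1" "z = (1 - u) *\<^sub>R P + u *\<^sub>R Q"
    by (auto simp: closed_segment_def)
  define l where "l = fst Q - fst P"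
  have Q: "fst Q = fst P + l" "snd Q = snd P + s * l" and "0 \<le> l"
    using assms by (auto simp: l_def)
  have "fst z = fst P + u * l" "snd z = snd P + s * (u * l)"
    unfolding u(3) by (simp_all add: Q algebra_simps)
  moreover have "0 \<le> u * l" "u * l \<le> l"
    using u \<open>0 \<le> l\<close> by (auto simp: mult_left_le_one_le)
  ultimately show "z \<in> ?R"
    using Q by (auto simp: case_prod_beta algebra_simps)
next
  fix z assume z: "z \<in> ?R"
  define l where "l = fst Q - fst P"
  define u where "u = (fst z - fst P) / l"
  have Q: "fst Q = fst P + l" "snd Q = snd P + s * l" and "0 < l"
    using assms by (auto simp: l_def)
  have "0 \<le> u" "u \<le> 1"
    using z \<open>0 < l\<close> by (auto simp: u_def l_def)
  moreover have ul: "u * l = fst z - fst P"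
    using \<open>0 < l\<close> by (simp add: u_def)
  have "snd z = snd P + s * (u * l)"
    unfolding ul using z Q by (auto simp: case_prod_beta algebra_simps)
  then have "z = (1 - u) *\<^sub>R P + u *\<^sub>R Q"
    using ul Q by (simp add: prod_eq_iff algebra_simps)
  ultimately show "z \<in> closed_segment P Q"
    by (auto simp: closed_segment_def)
qed

lemma consecutive_interval:
  fixes f :: "nat \<Rightarrow> real"
  assumes "1 \<le> k" and "f 0 \<le> x" and "x \<le> f k"
  shows "\<exists>i\<in>{1..k}. f (i - 1) \<le> x \<and> x \<le> f i"
  using assms
proof (induction k rule: dec_induct)
  case base
  then show ?case by auto
next
  case (step k)
  show ?case
  proof (cases "x \<le> f k")
    case True
    with step obtain i where "i \<in> {1..k}" "f (i - 1) \<le> x" "x \<le> f i"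
      by blast
    then show ?thesis by (intro bexI[of _ i]) auto
  next
    case False
    with step show ?thesis by (intro bexI[of _ "Suc k"]) auto
  qed
qed

text \<open>Edges lie in the hull because their endpoints are in \<open>S\<close>. Conversely, the
  half-plane above an edge line is convex and contains \<open>S\<close>, hence contains the hull, so
  over its own interval the edge is lowest. Convexity of the chain is encoded in
  \<open>S_above\<close>, which puts every vertex above every edge line.\<close>

lemma lower_convex_hull_eq_segments:
  fixes V :: "nat \<Rightarrow> real \<times> real" and s :: "nat \<Rightarrow> real"
  assumes k: "1 \<le> k"
    and V_in: "\<And>i. i \<le> k \<Longrightarrow> V i \<in> S"
    and V_less: "\<And>i. i \<in> {1..k} \<Longrightarrow> fst (V (i - 1)) < fst (V i)"
    and V_slope: "\<And>i. i \<in> {1..k} \<Longrightarrow>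
          snd (V i) - snd (V (i - 1)) = s i * (fst (V i) - fst (V (i - 1)))"
    and S_range: "\<And>z. z \<in> S \<Longrightarrow> fst (V 0) \<le> fst z \<and> fst z \<le> fst (V k)"
    and S_above: "\<And>z i. z \<in> S \<Longrightarrow> i \<in> {1..k} \<Longrightarrow>
          snd (V i) + s i * (fst z - fst (V i)) \<le> snd z"
  shows "lower_convex_hull S = (\<Union>i\<in>{1..k}. closed_segment (V (i - 1)) (V i))"
proof -
  have seg: "closed_segment (V (i - 1)) (V i) =
      {(x, y). fst (V (i - 1)) \<le> x \<and> x \<le> fst (V i) \<and> y = snd (V i) + s i * (x - fst (V i))}"
    if "i \<in> {1..k}" for i
    using closed_segment_graph[OF V_less[OF that] V_slope[OF that]] .
  have seg_hull: "closed_segment (V (i - 1)) (V i) \<subseteq> convex hull S" if "i \<in> {1..k}" for i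
    using that V_in by (intro closed_segment_subset_convex_hull hull_inc) auto
  have above: "snd (V i) + s i * (fst z - fst (V i)) \<le> snd z"
    if "z \<in> convex hull S" "i \<in> {1..k}" for z i
  proof -
    \<comment> \<open>The vector \<open>(s i, - 1)\<close> is a downward normal of the edge line,
      which puts the region into the standard half-space form.\<close>
    have "{z. snd (V i) + s i * (fst z - fst (V i)) \<le> snd z} =
        {z. (s i, - 1) \<bullet> z \<le> s i * fst (V i) - snd (V i)}"
      by (auto simp: inner_prod_def algebra_simps)
    then have "convex {z. snd (V i) + s i * (fst z - fst (V i)) \<le> snd z}"
      using convex_halfspace_le[of "(s i, - 1)" "s i * fst (V i) - snd (V i)"] by simp
    then have "convex hull S \<subseteq> {z. snd (V i) + s i * (fst z - fst (V i)) \<le> snd z}"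
      using S_above that by (intro hull_minimal) auto
    then show ?thesis using that by auto
  qed
  have range: "fst (V 0) \<le> fst z \<and> fst z \<le> fst (V k)" if "z \<in> convex hull S" for z
  proof -
    have "convex hull S \<subseteq> {fst (V 0)..fst (V k)} \<times> UNIV"
      using S_range by (intro hull_minimal convex_Times) (force simp: mem_Times_iff)+
    then show ?thesis using that by auto
  qed
  show ?thesis
  proof (intro equalityI subsetI)
    fix z assume z: "z \<in> lower_convex_hull S"
    then have z_hull: "z \<in> convex hull S"
      and z_min: "\<And>y. (fst z, y) \<in> convex hull S \<Longrightarrow> snd z \<le> y"
      by (auto simp: lower_convex_hull_def)
    obtain i where i: "i \<in> {1..k}" "fst (V (i - 1)) \<le> fst z" "fst z \<le> fst (V i)"
      using consecutive_interval[of k "\<lambda>i. fst (V i)" "fst z"] k range[OF z_hull] by auto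
    have "(fst z, snd (V i) + s i * (fst z - fst (V i))) \<in> closed_segment (V (i - 1)) (V i)"
      using i seg by auto
    then have "snd z \<le> snd (V i) + s i * (fst z - fst (V i))"
      using seg_hull i z_min by blast
    then have "snd z = snd (V i) + s i * (fst z - fst (V i))"
      using above[OF z_hull i(1)] by linarith
    then show "z \<in> (\<Union>i\<in>{1..k}. closed_segment (V (i - 1)) (V i))"
      using i seg by (auto simp: case_prod_beta)
  next
    fix z assume "z \<in> (\<Union>i\<in>{1..k}. closed_segment (V (i - 1)) (V i))"
    then obtain i where i: "i \<in> {1..k}" "z \<in> closed_segment (V (i - 1)) (V i)"
      by blast
    then have "snd z = snd (V i) + s i * (fst z - fst (V i))"
      using seg by auto
    then show "z \<in> lower_convex_hull S"
      using seg_hull[OF i(1)] i above[OF _ i(1)] by (force simp: lower_convex_hull_def)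
  qed
qed

section \<open>Binary digit sums\<close>

fun bit_sum :: "nat \<Rightarrow> nat" where
  "bit_sum c = (if c = 0 then 0 else c mod 2 + bit_sum (c div 2))"

declare bit_sum.simps [simp del]

lemma bit_sum_0 [simp]: "bit_sum 0 = 0"
  by (simp add: bit_sum.simps)

lemma bit_sum_double [simp]: "bit_sum (2 * q) = bit_sum q"
  by (subst bit_sum.simps) auto

lemma bit_sum_double_Suc [simp]: "bit_sum (Suc (2 * q)) = Suc (bit_sum q)"
  by (subst bit_sum.simps) auto

lemma bit_sum_pos: "0 < c \<Longrightarrow> 0 < bit_sum c"
proof (induction c rule: less_induct)
  case (less c)
  show ?case
  proof (cases "even c")
    case True
    then obtain q where "c = 2 * q" by blast
    with less show ?thesis by simp
  next
    case False
    then obtain q where "c = Suc (2 * q)" by (auto elim: oddE)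
    then show ?thesis by simp
  qed
qed

text \<open>The binary digits of \<open>e\<close> fit into the \<open>d\<close> low positions that
  \<open>2 ^ d * q\<close> leaves empty. The case \<open>e = 0\<close> is invariance under shifts,
  which is used repeatedly below.\<close>

lemma bit_sum_append: "e < 2 ^ d \<Longrightarrow> bit_sum (2 ^ d * q + e) = bit_sum q + bit_sum e"
proof (induction d arbitrary: e)
  case 0
  then show ?case by simp
next
  case (Suc d)
  define f where "f = e div 2"
  have f: "f < 2 ^ d" using Suc.prems by (auto simp: f_def)
  show ?case
  proof (cases "even e")
    case True
    then have e: "e = 2 * f" by (simp add: f_def)
    have "2 ^ Suc d * q + e = 2 * (2 ^ d * q + f)" by (simp add: e)
    then show ?thesis using Suc.IH[OF f] e by (metis bit_sum_double)
  next
    case False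
    then have e: "e = Suc (2 * f)" by (simp add: f_def)
    have "2 ^ Suc d * q + e = Suc (2 * (2 ^ d * q + f))" by (simp add: e)
    then show ?thesis using Suc.IH[OF f] e by (metis bit_sum_double_Suc add_Suc_right)
  qed
qed

section \<open>Legendre's formula at the prime 2 and its consequences\<close>

lemma multiplicity_2_odd: "odd (m :: nat) \<Longrightarrow> multiplicity 2 m = 0"
  by (simp add: not_dvd_imp_multiplicity_0)

lemma multiplicity_2_fact_double_Suc:
  "multiplicity 2 (fact (Suc (2 * q)) :: nat) = multiplicity 2 (fact (2 * q) :: nat)"
proof -
  have "multiplicity 2 (Suc (2 * q) * fact (2 * q) :: nat) = multiplicity 2 (fact (2 * q) :: nat)"
    by (subst prime_elem_multiplicity_mult_distrib) (auto simp: multiplicity_2_odd)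
  then show ?thesis by (metis fact_Suc of_nat_id)
qed

text \<open>The even factors of \<open>(2q)!\<close> are the doubles of \<open>1, ..., q\<close>.
  Accordingly, each induction step brings in an odd factor and the factor
  \<open>2 * Suc q\<close>.\<close>

lemma multiplicity_2_fact_double:
  "multiplicity 2 (fact (2 * q) :: nat) = q + multiplicity 2 (fact q :: nat)"
proof (induction q)
  case 0
  then show ?case by simp
next
  case (Suc q)
  have "(fact (2 * Suc q) :: nat) = 2 * (Suc q * fact (Suc (2 * q)))"
    by simp
  also have "multiplicity 2 \<dots> = Suc (multiplicity 2 (Suc q) + multiplicity 2 (fact (Suc (2 * q)) :: nat))"
    by (simp add: prime_elem_multiplicity_mult_distrib del: fact_Suc mult_Suc)
  also have "\<dots> = Suc (multiplicity 2 (Suc q) + (q + multiplicity 2 (fact q :: nat)))"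
    by (simp only: multiplicity_2_fact_double_Suc Suc.IH)
  also have "\<dots> = Suc q + multiplicity 2 (Suc q * fact q :: nat)"
    by (subst prime_elem_multiplicity_mult_distrib) auto
  finally show ?case by (metis fact_Suc of_nat_id)
qed

text \<open>Removing the last binary digit reduces \<open>c\<close> to \<open>c div 2\<close>. The
  additive form avoids truncated subtraction.\<close>

lemma legendre_2: "multiplicity 2 (fact c :: nat) + bit_sum c = c"
proof (induction c rule: less_induct)
  case (less c)
  show ?case
  proof (cases "c = 0")
    case False
    show ?thesis
    proof (cases "even c")
      case True
      then obtain q where "c = 2 * q" by blast
      with less[of q] False show ?thesis by (simp add: multiplicity_2_fact_double)
    next
      case False
      then obtain q where "c = Suc (2 * q)" by (auto elim: oddE)
      with less[of q] show ?thesis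
        by (simp add: multiplicity_2_fact_double_Suc multiplicity_2_fact_double del: fact_Suc)
    qed
  qed simp
qed

text \<open>Cutting off the \<open>d\<close> low digits reduces the claim to
  \<open>q - 2 * Q\<close> being at most \<open>bit_sum q - bit_sum Q\<close>. By Legendre this
  compares the valuations of \<open>q!\<close> and \<open>(2Q)!\<close>. The low part
  \<open>e\<close> contributes less than 1 to the line, but at least 1 to the digit sum unless it is
  0.\<close>

lemma bit_sum_above_line:
  assumes "2 ^ Suc d dvd M" and "c < M + 2 ^ Suc d"
  shows "real (bit_sum M) + (real c - real M) / 2 ^ d \<le> real (bit_sum c)"
proof -
  obtain Q where Q: "M = 2 ^ d * (2 * Q)"
    using assms(1) by (auto simp: dvd_def mult.assoc)
  define q e where "q = c div 2 ^ d" and "e = c mod 2 ^ d"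
  have e: "e < 2 ^ d" and c: "c = 2 ^ d * q + e"
    by (simp_all add: q_def e_def)
  have "2 ^ d * q < 2 ^ d * (2 * Q + 2)"
    using assms(2) c Q by (simp add: algebra_simps)
  then have "q < 2 * Q + 2"
    unfolding mult_less_cancel1 by (rule conjunct2)
  then have "q \<le> Suc (2 * Q)"
    by simp
  \<comment> \<open>The value \<open>q = 2 * Q + 1\<close> is allowed because the additional factor
    of the factorial is odd; this is where evenness of \<open>M / 2 ^ d\<close> enters.\<close>
  then have "multiplicity 2 (fact q :: nat) \<le> multiplicity 2 (fact (Suc (2 * Q)) :: nat)"
    by (intro dvd_imp_multiplicity_le fact_dvd) auto
  then have "multiplicity 2 (fact q :: nat) \<le> multiplicity 2 (fact (2 * Q) :: nat)"
    by (simp only: multiplicity_2_fact_double_Suc)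
  then have "q + bit_sum (2 * Q) \<le> 2 * Q + bit_sum q"
    using legendre_2[of q] legendre_2[of "2 * Q"] by linarith
  then have 1: "real q + real (bit_sum Q) \<le> 2 * real Q + real (bit_sum q)"
    by simp
  have 2: "real e / 2 ^ d \<le> real (bit_sum e)"
  proof (cases "e = 0")
    case False
    have "real e / 2 ^ d \<le> 1"
      using e by (simp add: less_imp_le)
    also have "\<dots> \<le> real (bit_sum e)"
      using bit_sum_pos[of e] False by simp
    finally show ?thesis .
  qed simp
  have "(real c - real M) / 2 ^ d = real q + real e / 2 ^ d - 2 * real Q"
    by (simp add: c Q field_simps)
  moreover have "bit_sum M = bit_sum Q"
    using bit_sum_append[of 0 d "2 * Q"] by (simp add: Q)
  moreover have "bit_sum c = bit_sum q + bit_sum e"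
    using bit_sum_append[OF e] by (simp add: c)
  ultimately show ?thesis using 1 2 by linarith
qed

text \<open>By Legendre, the valuation of the binomial coefficient is
  \<open>bit_sum a + bit_sum r - bit_sum (a + r)\<close>. This is Kummer's count of carries, and
  here the digits of \<open>a\<close> and \<open>r\<close> do not overlap.\<close>

lemma odd_binomial_no_carry:
  assumes "2 ^ d dvd a" and "r < 2 ^ d"
  shows "odd ((a + r) choose a)"
proof -
  obtain q where a: "a = 2 ^ d * q" using assms(1) by blast
  have "bit_sum (a + r) = bit_sum a + bit_sum r"
    using bit_sum_append[OF assms(2), of q] bit_sum_append[of 0 d q] by (simp add: a)
  moreover have "multiplicity 2 (fact (a + r) :: nat) =
      multiplicity 2 (fact a :: nat) + multiplicity 2 (fact r :: nat) + multiplicity 2 ((a + r) choose a)"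
  proof -
    have "(fact (a + r) :: nat) = fact a * fact r * ((a + r) choose a)"
      using binomial_fact_lemma[of a "a + r"] by simp
    then show ?thesis
      by (simp add: prime_elem_multiplicity_mult_distrib)
  qed
  ultimately have "multiplicity 2 ((a + r) choose a) = 0"
    using legendre_2[of a] legendre_2[of r] legendre_2[of "a + r"] by linarith
  then show ?thesis
    by (simp add: multiplicity_eq_zero_iff)
qed

section \<open>Valuations of the coefficients\<close>

text \<open>Cross-multiplying with the reduced fraction shows that any representation gives the same
  difference, so fractions over \<open>n!\<close> need not be reduced.\<close>

lemma padic_val_of_int_divide:
  assumes "prime p" and "a \<noteq> 0" and "b \<noteq> 0"
  shows "padic_val p (of_int a / of_int b) =
    int (multiplicity (int p) a) - int (multiplicity (int p) b)"
proof -
  define q :: rat where "q = of_int a / of_int b"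
  obtain u v where uv: "quotient_of q = (u, v)" by fastforce
  have v: "v > 0" using quotient_of_denom_pos[OF uv] .
  have "q = of_int u / of_int v" using quotient_of_div[OF uv] .
  then have "rat_of_int (a * v) = of_int (u * b)"
    using assms v by (simp add: q_def field_simps)
  then have eq: "a * v = u * b" by (simp only: of_int_eq_iff)
  then have "u \<noteq> 0" using assms v by auto
  then have "multiplicity (int p) a + multiplicity (int p) v =
      multiplicity (int p) u + multiplicity (int p) b"
    using arg_cong[OF eq, of "multiplicity (int p)"] assms v
    by (simp add: prime_elem_multiplicity_mult_distrib)
  then show ?thesis by (simp add: padic_val_def uv flip: q_def)
qed

text \<open>These are the signed Stirling numbers of the first kind.\<close>

definition falling_coeff :: "nat \<Rightarrow> nat \<Rightarrow> int" where
  "falling_coeff c m = coeff (\<Prod>i<c. [:- of_nat i, 1:]) m"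

lemma coeff_falling_of_int:
  "coeff (\<Prod>i<c. [:- of_nat i, 1:]) m = (of_int (falling_coeff c m) :: rat)"
  unfolding falling_coeff_def
  by (induction c arbitrary: m) (auto simp: mult.commute[of _ "[:_, 1:]"] coeff_pCons split: nat.splits)

lemma falling_coeff_eq_0: "c < m \<Longrightarrow> falling_coeff c m = 0"
  and falling_coeff_same: "falling_coeff c c = 1"
proof -
  have "falling_coeff c c = 1 \<and> (\<forall>m>c. falling_coeff c m = 0)"
    unfolding falling_coeff_def
    by (induction c) (auto simp: mult.commute[of _ "[:_, 1:]"] coeff_pCons split: nat.splits)
  then show "c < m \<Longrightarrow> falling_coeff c m = 0" "falling_coeff c c = 1" by auto
qed

text \<open>For \<open>c\<close> at most \<open>n\<close> the division is exact, and this is the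
  contribution of the \<open>c\<close>-th summand to the coefficient of \<open>x ^ m\<close>,
  cleared of the common denominator \<open>n!\<close>. Valuations thus become divisibility of
  integers.\<close>

definition kraw_term :: "nat \<Rightarrow> nat \<Rightarrow> nat \<Rightarrow> nat \<Rightarrow> int" where
  "kraw_term n T m c =
     (- 2) ^ c * (fact n div fact c) * int ((T - c) choose (n - c)) * falling_coeff c m"

lemma coeff_kraw_eq_sum:
  assumes "n \<le> T"
  shows "coeff (kraw n (int T)) m = of_int (\<Sum>c=m..n. kraw_term n T m c) / of_int (fact n)"
proof -
  have "coeff (kraw n (int T)) m =
      (\<Sum>c=0..n. (- 2) ^ c * (of_int (int T - int c) gchoose (n - c)) *
         (1 / fact c * of_int (falling_coeff c m)))"
    by (simp add: kraw_def coeff_sum binomial_poly_def coeff_falling_of_int)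
  also have "\<dots> = (\<Sum>c=0..n. of_int (kraw_term n T m c) / of_int (fact n))"
  proof (intro sum.cong refl)
    fix c assume "c \<in> {0..n}"
    then have c: "c \<le> n" by simp
    \<comment> \<open>Since \<open>c\<close> is at most \<open>n\<close>, hence at most
      \<open>T\<close>, the upper argument is a natural number and the generalized binomial is an
      ordinary one.\<close>
    have "rat_of_int (int T - int c) = of_nat (T - c)"
      using c assms by (simp add: of_nat_diff)
    then have g: "rat_of_int (int T - int c) gchoose (n - c) = of_nat ((T - c) choose (n - c))"
      by (simp only: binomial_gbinomial)
    have "(fact n :: int) = (fact n div fact c) * fact c"
      using fact_dvd[OF c, where ?'a = int] by simp
    then have "rat_of_int (fact n) = of_int (fact n div fact c) * of_int (fact c)"
      by (metis of_int_mult)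
    then have "rat_of_int (fact n div fact c) = fact n / fact c"
      by (simp add: field_simps)
    then show "(- 2) ^ c * (rat_of_int (int T - int c) gchoose (n - c)) *
        (1 / fact c * of_int (falling_coeff c m)) = of_int (kraw_term n T m c) / of_int (fact n)"
      unfolding g kraw_term_def by simp
  qed
  also have "\<dots> = of_int (\<Sum>c=0..n. kraw_term n T m c) / of_int (fact n)"
    by (simp add: sum_divide_distrib)
  also have "(\<Sum>c=0..n. kraw_term n T m c) = (\<Sum>c=m..n. kraw_term n T m c)"
    by (intro sum.mono_neutral_right) (auto simp: kraw_term_def falling_coeff_eq_0)
  finally show ?thesis .
qed

lemma multiplicity_2_int_fact: "multiplicity 2 (fact n :: int) = multiplicity 2 (fact n :: nat)"
proof (rule multiplicity_eqI)
  have iff: "(2 :: int) ^ h dvd fact n \<longleftrightarrow> (2 :: nat) ^ h dvd fact n" for h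
    using int_dvd_int_iff[of "2 ^ h" "fact n"] by simp
  show "(2 :: int) ^ multiplicity 2 (fact n :: nat) dvd fact n"
    unfolding iff by (rule multiplicity_dvd)
  show "\<not> (2 :: int) ^ Suc (multiplicity 2 (fact n :: nat)) dvd fact n"
    unfolding iff by (simp add: power_dvd_iff_le_multiplicity del: power_Suc)
qed

text \<open>By Legendre, \<open>2 ^ c / c!\<close> has valuation \<open>bit_sum c\<close>; the
  remaining summand comes from the factor \<open>n!\<close>.\<close>

lemma multiplicity_kraw_scale:
  assumes "c \<le> n"
  shows "multiplicity 2 ((- 2) ^ c * (fact n div fact c) :: int) =
    bit_sum c + multiplicity 2 (fact n :: int)"
proof -
  have f: "(fact n :: int) = (fact n div fact c) * fact c"
    using fact_dvd[OF assms, where ?'a = int] by simp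
  then have nz: "(fact n div fact c :: int) \<noteq> 0"
    by (metis fact_nonzero mult_zero_left)
  have "multiplicity 2 (fact n :: int) =
      multiplicity 2 (fact n div fact c :: int) + multiplicity 2 (fact c :: int)"
    using nz by (subst f, subst prime_elem_multiplicity_mult_distrib) auto
  moreover have "multiplicity 2 ((- 2) ^ c :: int) = c"
  proof -
    have "multiplicity 2 ((- 2) ^ c :: int) = multiplicity 2 (2 ^ c :: int)"
      by (cases "even c") (simp_all add: power_minus_odd)
    then show ?thesis by simp
  qed
  ultimately show ?thesis
    using nz legendre_2[of c]
    by (simp add: prime_elem_multiplicity_mult_distrib multiplicity_2_int_fact)
qed

text \<open>The binomial and Stirling factors are integers, so they cannot lower the valuation of
  the scale factor.\<close>

lemma power_dvd_kraw_term:
  assumes "c \<le> n" and "h \<le> bit_sum c"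
  shows "2 ^ (h + multiplicity 2 (fact n :: int)) dvd kraw_term n T m c"
proof -
  have "2 ^ (h + multiplicity 2 (fact n :: int)) dvd ((- 2) ^ c * (fact n div fact c) :: int)"
    using multiplicity_kraw_scale[OF assms(1)] assms(2) by (intro multiplicity_dvd') auto
  then show ?thesis
    unfolding kraw_term_def by (simp only: dvd_mult2)
qed

lemma padic_val_coeff_kraw_ge:
  assumes "n \<le> T" and "coeff (kraw n (int T)) m \<noteq> 0"
    and "\<And>c. m \<le> c \<Longrightarrow> c \<le> n \<Longrightarrow> h \<le> bit_sum c"
  shows "int h \<le> padic_val 2 (coeff (kraw n (int T)) m)"
proof -
  define A where "A = (\<Sum>c=m..n. kraw_term n T m c)"
  have A: "coeff (kraw n (int T)) m = of_int A / of_int (fact n)"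
    using coeff_kraw_eq_sum[OF assms(1)] by (simp add: A_def)
  have nz: "A \<noteq> 0" using assms(2) A by auto
  have "2 ^ (h + multiplicity 2 (fact n :: int)) dvd A"
    unfolding A_def using assms(3) by (intro dvd_sum power_dvd_kraw_term) auto
  then have "h + multiplicity 2 (fact n :: int) \<le> multiplicity 2 A"
    using nz by (intro multiplicity_geI) auto
  then show ?thesis
    unfolding A using nz padic_val_of_int_divide[of 2 A "fact n"] by simp
qed

text \<open>The term \<open>c = m\<close> has Stirling factor 1 and an odd binomial factor, so its
  valuation is exact. All later terms are divisible by a higher power of 2, so it alone determines
  the valuation of the sum.\<close>

lemma padic_val_coeff_kraw_eq:
  assumes "m \<le> n" and "n \<le> T" and odd: "odd ((T - m) choose (n - m))"
    and less: "\<And>c. m < c \<Longrightarrow> c \<le> n \<Longrightarrow> bit_sum m < bit_sum c"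
  shows "coeff (kraw n (int T)) m \<noteq> 0"
    and "padic_val 2 (coeff (kraw n (int T)) m) = int (bit_sum m)"
proof -
  define A where "A = (\<Sum>c=m..n. kraw_term n T m c)"
  define h where "h = bit_sum m + multiplicity 2 (fact n :: int)"
  have A: "coeff (kraw n (int T)) m = of_int A / of_int (fact n)"
    using coeff_kraw_eq_sum[OF assms(2)] by (simp add: A_def)
  have A_split: "A = kraw_term n T m m + (\<Sum>c=Suc m..n. kraw_term n T m c)"
    unfolding A_def using assms(1) by (simp add: sum.atLeast_Suc_atMost)
  have rest: "2 ^ Suc h dvd (\<Sum>c=Suc m..n. kraw_term n T m c)"
    using power_dvd_kraw_term[where h = "Suc (bit_sum m)"] less
    by (intro dvd_sum) (auto simp: h_def Suc_le_eq)
  have nz: "((- 2) ^ m * (fact n div fact m) :: int) \<noteq> 0"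
    using fact_dvd[OF assms(1), where ?'a = int] by auto
  have "multiplicity 2 (kraw_term n T m m) = h"
  proof -
    have "multiplicity 2 (int ((T - m) choose (n - m))) = 0"
      using odd by (simp add: not_dvd_imp_multiplicity_0)
    moreover have "int ((T - m) choose (n - m)) \<noteq> 0"
      using odd by (metis even_zero of_nat_eq_0_iff)
    ultimately show ?thesis
      unfolding kraw_term_def falling_coeff_same h_def mult_1_right
      using nz multiplicity_kraw_scale[OF assms(1)]
      by (subst prime_elem_multiplicity_mult_distrib) simp_all
  qed
  moreover have "kraw_term n T m m \<noteq> 0"
    using nz assms(2) by (auto simp: kraw_term_def falling_coeff_same)
  ultimately have main: "2 ^ h dvd kraw_term n T m m" "\<not> 2 ^ Suc h dvd kraw_term n T m m"
    by (simp_all add: power_dvd_iff_le_multiplicity del: power_Suc)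
  have "2 ^ h dvd A" "\<not> 2 ^ Suc h dvd A"
    unfolding A_split using main rest
    by (auto simp: dvd_add_left_iff intro!: dvd_add intro: power_le_dvd)
  then have "multiplicity 2 A = h" "A \<noteq> 0"
    by (auto intro: multiplicity_eqI)
  then show "coeff (kraw n (int T)) m \<noteq> 0"
    and "padic_val 2 (coeff (kraw n (int T)) m) = int (bit_sum m)"
    unfolding A using padic_val_of_int_divide[of 2 A "fact n"] by (simp_all add: h_def)
qed

lemma degree_kraw:
  assumes "n \<le> T"
  shows "degree (kraw n (int T)) = n"
proof (rule antisym)
  show "degree (kraw n (int T)) \<le> n"
    using coeff_kraw_eq_sum[OF assms] by (intro degree_le) auto
  \<comment> \<open>For \<open>m = n\<close> the binomial coefficient is 1 and there are no later
    terms.\<close>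
  show "n \<le> degree (kraw n (int T))"
    using padic_val_coeff_kraw_eq(1)[of n n T] assms by (intro le_degree) auto
qed

section \<open>The Newton polygon\<close>

text \<open>Together with the next lemma this supplies the hypotheses of
  \<open>bit_sum_above_line\<close> for \<open>M\<close> the sum of the powers after the
  \<open>i\<close>-th and any \<open>c\<close> up to \<open>n\<close>.\<close>

lemma sum_powers_less:
  fixes j :: "nat \<Rightarrow> nat"
  assumes "strict_mono_on {1..k} j" and "i \<in> {1..k}"
  shows "(\<Sum>l=1..i. 2 ^ j l) < (2 ^ Suc (j i) :: nat)"
proof -
  have "1 \<le> i" using assms by simp
  then show ?thesis using assms(2)
  proof (induction i rule: dec_induct)
    case (step i)
    have "j i < j (Suc i)"
      using assms(1) step by (auto intro: strict_mono_onD)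
    then have "(2 :: nat) ^ Suc (j i) \<le> 2 ^ j (Suc i)"
      by (intro power_increasing) auto
    then show ?case using step by simp
  qed simp
qed

lemma power_dvd_sum_powers:
  fixes j :: "nat \<Rightarrow> nat"
  assumes "strict_mono_on {1..k} j" and "i \<in> {1..k}"
  shows "(2 :: nat) ^ Suc (j i) dvd (\<Sum>l=Suc i..k. 2 ^ j l)"
proof (intro dvd_sum le_imp_power_dvd)
  fix l assume "l \<in> {Suc i..k}"
  then show "Suc (j i) \<le> j l"
    using strict_mono_onD[OF assms(1), of i l] assms(2) by auto
qed

lemma bit_sum_sum_powers:
  fixes j :: "nat \<Rightarrow> nat"
  assumes "strict_mono_on {1..k} j" and "i \<le> k"
  shows "bit_sum (\<Sum>l=Suc i..k. 2 ^ j l) = k - i"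
  using assms(2)
proof (induction i rule: inc_induct)
  case (step i)
  define M where "M = (\<Sum>l=Suc (Suc i)..k. 2 ^ j l :: nat)"
  obtain q where q: "M = 2 ^ Suc (j (Suc i)) * q"
    using power_dvd_sum_powers[OF assms(1), of "Suc i"] step by (auto simp: M_def)
  have pow: "bit_sum (2 ^ d) = 1" for d
    using bit_sum_append[of 0 d 1] bit_sum_double_Suc[of 0] by simp
  \<comment> \<open>The new power lies strictly below all binary digits of \<open>M\<close>, so it
    adds one digit without a carry.\<close>
  have "bit_sum (M + 2 ^ j (Suc i)) = bit_sum q + 1"
    unfolding q by (subst bit_sum_append) (simp_all add: pow)
  moreover have "bit_sum M = bit_sum q"
    using bit_sum_append[of 0 "Suc (j (Suc i))" q] by (simp add: q)
  moreover have "(\<Sum>l=Suc i..k. 2 ^ j l) = M + 2 ^ j (Suc i)"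
    using step by (simp add: M_def sum.atLeast_Suc_atMost)
  ultimately show ?case using step by (simp add: M_def)
qed simp

theorem theorem1p2:
  fixes n k :: nat and j :: "nat \<Rightarrow> nat" and t :: int
  assumes "n \<ge> 1"
    and "strict_mono_on {1..k} j"
    and "n = (\<Sum>i=1..k. 2 ^ j i)"
    and "int n \<le> t"
    and "t < int n + 2 ^ j 1"
  shows "consists_of_segments (newton_polygon 2 (kraw n t)) k
           (\<lambda>i. 2 ^ j i) (\<lambda>i. - (1 / 2 ^ j i))"
proof -
  note mono = assms(2)
  define T where "T = nat t"
  have t: "t = int T" and nT: "n \<le> T" and r: "T - n < 2 ^ j 1"
  proof -
    show t: "t = int T" and "n \<le> T" using assms(4) by (simp_all add: T_def le_nat_iff)
    have "int T < int (n + 2 ^ j 1)" using assms(5) t by simp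
    then have "T < n + 2 ^ j 1" by (simp only: of_nat_less_iff)
    then show "T - n < 2 ^ j 1" using \<open>n \<le> T\<close> by linarith
  qed
  have k: "1 \<le> k" using assms by (cases k) auto
  \<comment> \<open>The coefficient of \<open>x ^ m\<close> sits at abscissa \<open>n - m\<close>;
    thus \<open>L i\<close> is the abscissa of the \<open>i\<close>-th vertex and \<open>M i\<close>
    the exponent belonging to it.\<close>
  define L M where "L i = (\<Sum>l=1..i. 2 ^ j l :: nat)" and "M i = (\<Sum>l=Suc i..k. 2 ^ j l :: nat)"
    for i
  have LM: "L i + M i = n" if "i \<le> k" for i
    using sum.ub_add_nat[of 1 i "\<lambda>l. 2 ^ j l :: nat" "k - i"] that
    unfolding L_def M_def assms(3) by simp
  have L_step: "L i = L (i - 1) + 2 ^ j i" if "i \<in> {1..k}" for i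
    using that by (cases i) (auto simp: L_def)
  have L_0: "L 0 = 0" and L_k: "L k = n" by (simp_all add: L_def assms(3))
  have bit_M: "bit_sum (M i) = k - i" if "i \<le> k" for i
    using bit_sum_sum_powers[OF mono that] by (simp add: M_def)
  have line: "real (k - i) + (real c - real (M i)) / 2 ^ j i \<le> real (bit_sum c)"
    if "i \<in> {1..k}" "c \<le> n" for i c
  proof -
    have "c < M i + 2 ^ Suc (j i)"
      using sum_powers_less[OF mono that(1)] LM[of i] that by (simp add: L_def)
    then show ?thesis
      using bit_sum_above_line[of "j i" "M i" c] power_dvd_sum_powers[OF mono that(1)]
        bit_M[of i] that by (simp add: M_def)
  qed
  have vertex: "coeff (kraw n t) (M i) \<noteq> 0"
      "padic_val 2 (coeff (kraw n t) (M i)) = int (k - i)" if "i \<le> k" for i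
  proof -
    \<comment> \<open>Every exponent \<open>j l\<close> is at least \<open>j 1\<close>, so
      \<open>T - n < 2 ^ j 1\<close> fits below the digits of \<open>L i = n - M i\<close>.\<close>
    have "2 ^ j 1 dvd L i"
      unfolding L_def using that
      by (intro dvd_sum le_imp_power_dvd) (auto intro: strict_mono_on_leD[OF mono])
    then have "odd ((L i + (T - n)) choose L i)"
      using odd_binomial_no_carry r by blast
    moreover have "L i + (T - n) = T - M i" "L i = n - M i"
      using LM[OF that] nT by linarith+
    ultimately have "odd ((T - M i) choose (n - M i))" by metis
    moreover have "bit_sum (M i) < bit_sum c" if "M i < c" "c \<le> n" for c
    proof -
      \<comment> \<open>For \<open>i = 0\<close> the exponent is \<open>M 0 = n\<close>, and no
        \<open>c\<close> lies strictly above it. For other \<open>i\<close> the line inequality is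
        strict beyond the vertex.\<close>
      have "i \<noteq> 0" using that LM[of 0] L_0 by (intro notI) simp
      then have "real (k - i) + (real c - real (M i)) / 2 ^ j i \<le> real (bit_sum c)"
        using line \<open>i \<le> k\<close> that by simp
      moreover have "0 < (real c - real (M i)) / 2 ^ j i" using that by simp
      ultimately have "real (k - i) < real (bit_sum c)" by linarith
      then show ?thesis using bit_M[OF \<open>i \<le> k\<close>] by simp
    qed
    moreover have "M i \<le> n" using LM[OF that] by linarith
    ultimately show "coeff (kraw n t) (M i) \<noteq> 0"
        "padic_val 2 (coeff (kraw n t) (M i)) = int (k - i)"
      using padic_val_coeff_kraw_eq[of "M i" n T] nT bit_M[OF that] t by auto
  qed
  have deg: "degree (kraw n t) = n" using degree_kraw[OF nT] t by simp
  have above: "real (k - i) + (real m - real (M i)) / 2 ^ j i \<le>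
      real_of_int (padic_val 2 (coeff (kraw n t) m))"
    if "i \<in> {1..k}" "coeff (kraw n t) m \<noteq> 0" for i m
  proof -
    have "m \<le> n" using le_degree[OF that(2)] deg by simp
    \<comment> \<open>The valuation is at least the smallest digit sum on \<open>{m..n}\<close>. The
      \<open>c\<close> attaining it is at least \<open>m\<close>, and the line increases with the
      exponent, so the bound at \<open>c\<close> implies the bound at \<open>m\<close>.\<close>
    define h where "h = Min (bit_sum ` {m..n})"
    have "h \<in> bit_sum ` {m..n}"
      unfolding h_def using \<open>m \<le> n\<close> by (intro Min_in) auto
    then obtain c where c: "m \<le> c" "c \<le> n" "h = bit_sum c" by auto
    have "real (k - i) + (real m - real (M i)) / 2 ^ j i \<le>
        real (k - i) + (real c - real (M i)) / 2 ^ j i"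
      using c by (intro add_left_mono divide_right_mono) auto
    also have "\<dots> \<le> real h" using line[OF that(1) c(2)] c by simp
    also have "int h \<le> padic_val 2 (coeff (kraw n t) m)"
      unfolding t using that(2) t
      by (intro padic_val_coeff_kraw_ge nT) (auto simp: h_def)
    then have "real h \<le> real_of_int (padic_val 2 (coeff (kraw n t) m))" by linarith
    finally show ?thesis .
  qed
  \<comment> \<open>The height is \<open>bit_sum (M i)\<close>. Each edge drops by exactly 1, which
    over the length \<open>2 ^ j i\<close> gives the slope.\<close>
  define V where "V i = (real (L i), real (k - i))" for i
  have V_step: "fst (V i) - fst (V (i - 1)) = 2 ^ j i"
      "snd (V i) - snd (V (i - 1)) = - (1 / 2 ^ j i) * 2 ^ j i" if "i \<in> {1..k}" for i
    using that L_step[OF that] by (auto simp: V_def of_nat_diff)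
  have "newton_polygon 2 (kraw n t) = (\<Union>i\<in>{1..k}. closed_segment (V (i - 1)) (V i))"
    unfolding newton_polygon_def
  proof (rule lower_convex_hull_eq_segments[where s = "\<lambda>i. - (1 / 2 ^ j i)"])
    fix i assume i: "i \<le> k"
    have "L i = n - M i" using LM[OF i] by linarith
    then show "V i \<in> newton_points 2 (kraw n t)"
      unfolding newton_points_def V_def deg using vertex[OF i] by force
  next
    fix i assume i: "i \<in> {1..k}"
    have "(0 :: real) < 2 ^ j i" by simp
    then show "fst (V (i - 1)) < fst (V i)" using V_step(1)[OF i] by linarith
    show "snd (V i) - snd (V (i - 1)) = - (1 / 2 ^ j i) * (fst (V i) - fst (V (i - 1)))"
      using V_step[OF i] by simp
  next
    fix z assume "z \<in> newton_points 2 (kraw n t)"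
    then obtain m where m: "coeff (kraw n t) m \<noteq> 0"
      and z: "z = (real (n - m), real_of_int (padic_val 2 (coeff (kraw n t) m)))"
      by (auto simp: newton_points_def deg)
    have "m \<le> n" using le_degree[OF m] deg by simp
    then show "fst (V 0) \<le> fst z \<and> fst z \<le> fst (V k)"
      by (simp add: z V_def L_0 L_k)
    fix i assume i: "i \<in> {1..k}"
    \<comment> \<open>This translates the line from abscissas to exponents:
      \<open>(n - m) - L i\<close> equals \<open>M i - m\<close>, so the negative slope becomes
      positive in \<open>m\<close>.\<close>
    have "real n = real (L i) + real (M i)" using LM[of i] i by (simp flip: of_nat_add)
    then have "- (1 / 2 ^ j i) * (real (n - m) - real (L i)) = (real m - real (M i)) / 2 ^ j i"
      using \<open>m \<le> n\<close> by (simp add: of_nat_diff field_simps)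
    then show "snd (V i) + - (1 / 2 ^ j i) * (fst z - fst (V i)) \<le> snd z"
      using above[OF i m] by (simp add: z V_def)
  qed (rule k)
  moreover have "strict_mono_on {1..k} (\<lambda>i. - (1 / 2 ^ j i :: real))"
  proof (rule strict_mono_onI)
    fix a b assume "a \<in> {1..k}" "b \<in> {1..k}" "a < b"
    then have "j a < j b" by (rule strict_mono_onD[OF mono])
    then have "(2 :: real) ^ j a < 2 ^ j b" by simp
    then show "- (1 / 2 ^ j a :: real) < - (1 / 2 ^ j b)" by (simp add: field_simps)
  qed
  ultimately show ?thesis
    unfolding consists_of_segments_def using V_step by auto
qed

end
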